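(* Let $\rho\in[0,\tfrac12)$, $\delta\in(0,1)$. In the online prediction with abstention setting with $K$ experts and $T$ rounds defined in the context, with probability at least $1-\delta$, Algorithm 4 (AdaHedge with abstention, defined in the context) guarantees $$\sum_{t=1}^T\big(a_t\,\ell_t(\mathrm{sign}(\hat y_t))+(1-a_t)\rho\big)\le\sum_{t=1}^T\ell_t(y_t^\star)+\frac{2\log K}{1-2\rho}+\frac{21\log(1/\delta)}{8(1-2\rho)}+\frac43\log K+2,$$ where $y_t^\star=y_t(i^\star)$ and $i^\star=\arg\min_i\sum_{t=1}^T\ell_t(y_t(i))$.
   Context: Setting: in each round $t=1,\ldots,T$ the learner receives expert predictions $y_t(1),\ldots,y_t(K)\in[-1,1]$ and either predicts $\tilde y_t\in[-1,1]$ ($a_t=1$) or abstains ($a_t=0$). If it predicts, it suffers $\ell_t(\tilde y_t)$, where $\ell_t(y)=\tfrac12(1-y\,y_t)$ and $y_t\in\{-1,1\}$ is the outcome; if it abstains, it suffers the abstention cost $\rho$. $\log$ is the natural logarithm. Algorithm 4: in round $t$, obtain a distribution $p_t$ over experts from AdaHedge; set $\hat y_t=\sum_{i=1}^Kp_t(i)y_t(i)$, $\tilde y_t=\mathrm{sign}(\hat y_t)$, $b_t=1-|\hat y_t|$; draw $a_t$ from a Bernoulli distribution with parameter $1-b_t$ (conditionally on the past); if $a_t=1$ predict $\tilde y_t$, otherwise abstain; receive $y_t$ and send the losses $\tfrac12(1-y_t(i)y_t)\in[0,1]$, $i=1,\dots,K$, to AdaHedge. AdaHedge (de Rooij et al.,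 2014), fed with loss vectors $l_t\in[0,1]^K$: let $L_{t}(i)=\sum_{s\le t}l_s(i)$, $\Delta_0=0$, and $\eta_t=\log K/\Delta_{t-1}$ ($\eta_t=\infty$ if $\Delta_{t-1}=0$). Play $p_t(i)\propto\exp(-\eta_tL_{t-1}(i))$ (uniform on the minimizers of $L_{t-1}$ if $\eta_t=\infty$). After $l_t$ is revealed, set $h_t=\sum_ip_t(i)l_t(i)$, $m_t=-\frac1{\eta_t}\log\sum_ip_t(i)e^{-\eta_tl_t(i)}$ (if $\eta_t=\infty$, $m_t=\min_iL_t(i)-\min_iL_{t-1}(i)$), and $\Delta_t=\Delta_{t-1}+h_t-m_t$. *)

theory Defs
  imports "HOL-Probability.Probability"
begin

section \<open>AdaHedge\<close>

text \<open>
  Experts are the numbers \<open>1..K\<close> and rounds start at \<open>1\<close>; \<open>l t i\<close> is the loss of expert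
  \<open>i\<close> in round \<open>t\<close>.
\<close>

definition cum_loss :: "(nat \<Rightarrow> nat \<Rightarrow> real) \<Rightarrow> nat \<Rightarrow> nat \<Rightarrow> real" where
  "cum_loss l t i = (\<Sum>s = 1..t. l s i)"

definition minimizers :: "nat \<Rightarrow> (nat \<Rightarrow> real) \<Rightarrow> nat set" where
  "minimizers K L = {i. is_arg_min L (\<lambda>j. j \<in> {1..K}) i}"

definition hedge_weight :: "nat \<Rightarrow> ereal \<Rightarrow> (nat \<Rightarrow> real) \<Rightarrow> nat \<Rightarrow> real" where
  "hedge_weight K \<eta> L i =
    (if \<eta> = \<infinity> then indicator (minimizers K L) i / real (card (minimizers K L))
     else exp (- real_of_ereal \<eta> * L i) / (\<Sum>j = 1..K. exp (- real_of_ereal \<eta> * L j)))"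

definition hedge_loss :: "nat \<Rightarrow> ereal \<Rightarrow> (nat \<Rightarrow> real) \<Rightarrow> (nat \<Rightarrow> real) \<Rightarrow> real" where
  "hedge_loss K \<eta> L l = (\<Sum>i = 1..K. hedge_weight K \<eta> L i * l i)"

text \<open>In \<open>hedge_loss\<close> and \<open>mix_loss\<close>, \<open>L\<close> is the cumulative loss before the loss vector \<open>l\<close> is added.\<close>

definition mix_loss :: "nat \<Rightarrow> ereal \<Rightarrow> (nat \<Rightarrow> real) \<Rightarrow> (nat \<Rightarrow> real) \<Rightarrow> real" where
  "mix_loss K \<eta> L l =
    (if \<eta> = \<infinity> then (MIN i\<in>{1..K}. L i + l i) - (MIN i\<in>{1..K}. L i)
     else - (1 / real_of_ereal \<eta>) *
       ln (\<Sum>i = 1..K. hedge_weight K \<eta> L i * exp (- real_of_ereal \<eta> * l i)))"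

definition adahedge_rate :: "nat \<Rightarrow> real \<Rightarrow> ereal" where
  "adahedge_rate K \<Delta> = (if \<Delta> = 0 then \<infinity> else ereal (ln (real K) / \<Delta>))"

primrec adahedge_gap :: "nat \<Rightarrow> (nat \<Rightarrow> nat \<Rightarrow> real) \<Rightarrow> nat \<Rightarrow> real" where
  "adahedge_gap K l 0 = 0"
| "adahedge_gap K l (Suc t) =
    (let \<Delta> = adahedge_gap K l t; \<eta> = adahedge_rate K \<Delta>; L = cum_loss l t
     in \<Delta> + hedge_loss K \<eta> L (l (Suc t)) - mix_loss K \<eta> L (l (Suc t)))"

text \<open>
  The distribution played in round \<open>t\<close> (for \<open>t \<ge> 1\<close>); it depends on \<open>l\<close> only through the rounds
  before \<open>t\<close>.
\<close>

definition adahedge :: "nat \<Rightarrow> (nat \<Rightarrow> nat \<Rightarrow> real) \<Rightarrow> nat \<Rightarrow> nat \<Rightarrow> real" where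
  "adahedge K l t i =
    hedge_weight K (adahedge_rate K (adahedge_gap K l (t - 1))) (cum_loss l (t - 1)) i"


section \<open>Prediction with abstention\<close>

text \<open>
  The loss \<open>\<ell>\<^sub>t(z)\<close> when the outcome is \<open>y\<^sub>t\<close> is \<open>pred_loss y\<^sub>t z\<close>. The random processes are
  \<open>e t i \<omega>\<close> (prediction of expert \<open>i\<close> in round \<open>t\<close>), \<open>y t \<omega>\<close> (outcome) and
  \<open>a t \<omega>\<close> (\<open>1\<close> for predicting, \<open>0\<close> for abstaining).
\<close>

definition pred_loss :: "real \<Rightarrow> real \<Rightarrow> real" where
  "pred_loss yt z = (1 - z * yt) / 2"

definition aggregate ::
  "nat \<Rightarrow> (nat \<Rightarrow> nat \<Rightarrow> 'w \<Rightarrow> real) \<Rightarrow> (nat \<Rightarrow> 'w \<Rightarrow> real) \<Rightarrow> nat \<Rightarrow> 'w \<Rightarrow> real" where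
  "aggregate K e y t \<omega> =
    (\<Sum>i = 1..K. adahedge K (\<lambda>s j. pred_loss (y s \<omega>) (e s j \<omega>)) t i * e t i \<omega>)"

definition abstain_prob ::
  "nat \<Rightarrow> (nat \<Rightarrow> nat \<Rightarrow> 'w \<Rightarrow> real) \<Rightarrow> (nat \<Rightarrow> 'w \<Rightarrow> real) \<Rightarrow> nat \<Rightarrow> 'w \<Rightarrow> real" where
  "abstain_prob K e y t \<omega> = 1 - \<bar>aggregate K e y t \<omega>\<bar>"

text \<open>
  The sigma-algebra \<open>G t\<close> is the past at the moment when \<open>a\<^sub>t\<close> is drawn. It contains the earlier
  draws, so expert predictions and outcomes may be chosen by an adaptive (and possibly randomized)
  adversary. It also contains the outcome of round \<open>t\<close>: the learner does not see it before drawing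
  \<open>a\<^sub>t\<close>, but the adversary has to fix it without knowing \<open>a\<^sub>t\<close>.
\<close>

locale abstention_game = prob_space M + filtration "space M" G
  for M :: "'w measure" and G :: "nat \<Rightarrow> 'w measure" +
  fixes K T :: nat
    and e :: "nat \<Rightarrow> nat \<Rightarrow> 'w \<Rightarrow> real"
    and y a :: "nat \<Rightarrow> 'w \<Rightarrow> real"
  assumes K_pos: "K \<ge> 1"
    and subalg: "\<And>t. subalgebra M (G t)"
    and expert_measurable:
      "\<And>t i. t \<in> {1..T} \<Longrightarrow> i \<in> {1..K} \<Longrightarrow> e t i \<in> borel_measurable (G t)"
    and outcome_measurable: "\<And>t. t \<in> {1..T} \<Longrightarrow> y t \<in> borel_measurable (G t)"
    and action_measurable: "\<And>t. t \<in> {1..T} \<Longrightarrow> a t \<in> borel_measurable (G (Suc t))"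
    and expert_range:
      "\<And>t i \<omega>. t \<in> {1..T} \<Longrightarrow> i \<in> {1..K} \<Longrightarrow> \<omega> \<in> space M \<Longrightarrow> e t i \<omega> \<in> {-1..1}"
    and outcome_range: "\<And>t \<omega>. t \<in> {1..T} \<Longrightarrow> \<omega> \<in> space M \<Longrightarrow> y t \<omega> \<in> {-1, 1}"
    and action_range: "\<And>t \<omega>. t \<in> {1..T} \<Longrightarrow> \<omega> \<in> space M \<Longrightarrow> a t \<omega> \<in> {0, 1}"

locale adahedge_with_abstention = abstention_game +
  assumes action_distr: "\<And>t. t \<in> {1..T} \<Longrightarrow>
    AE \<omega> in M. real_cond_exp M (G t) (indicator {\<omega> \<in> space M. a t \<omega> = 1}) \<omega>
      = 1 - abstain_prob K e y t \<omega>"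

end

theory Submission
  imports Defs
begin

text \<open>
  Write \<open>g = 1 - 2 * \<rho>\<close>, \<open>b\<^sub>t\<close> for the abstention probability and \<open>h\<^sub>t\<close> for the loss of
  AdaHedge, which is the prediction loss of the weighted mean. Whether or not the sign is correct, the
  conditional mean of the learner's loss is exactly \<open>h\<^sub>t - b\<^sub>t * g / 2\<close>. Half of the gain
  \<open>b\<^sub>t * g / 2\<close> pays for the second-order regret of AdaHedge, since the variance of the experts'
  losses is at most \<open>h\<^sub>t * (1 - h\<^sub>t) \<le> b\<^sub>t / 2\<close>. The other half pays for the randomization: if
  \<open>d\<^sub>t\<close> is the deviation of the learner's loss from its conditional mean, then
  \<open>exp (8 * g / 21 * (d\<^sub>t - b\<^sub>t * g / 4))\<close> has conditional mean at most \<open>1\<close>. So the product over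
  the rounds is a supermartingale, and Markov's inequality yields the term in \<open>ln (1 / \<delta>)\<close>.

  The AdaHedge bound follows de Rooij et al.: the mix losses telescope into a potential that decreases in
  the rate, so the regret is at most \<open>2 * \<Delta>\<^sub>T\<close>, and Bernstein's inequality for the mixability gaps
  turns the increments of \<open>\<Delta>\<^sub>t\<^sup>2\<close> into variances plus terms linear in the gaps.
\<close>

section \<open>The regret of AdaHedge\<close>

lemma bernstein_aux:
  fixes x :: real
  shows "2 * (exp x - 1 - x) * (1 - x / 3) \<le> x\<^sup>2"
proof -
  \<comment> \<open>Up to the factor 2 / 3, \<open>k\<close> is the derivative of \<open>g\<close>.
    It is nondecreasing, because \<open>exp (- x) \<ge> 1 - x\<close>, and vanishes at 0, so
    \<open>g\<close> attains its minimum 0 there.\<close>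
  define k where "k = (\<lambda>x::real. x + 2 + (x - 2) * exp x)"
  define g where "g = (\<lambda>x::real. x\<^sup>2 - 2 * (exp x - 1 - x) * (1 - x / 3))"
  have dk: "(k has_real_derivative 1 + (x - 1) * exp x) (at x)" for x
    unfolding k_def by (auto intro!: derivative_eq_intros simp: algebra_simps)
  have dk_nonneg: "1 + (x - 1) * exp x \<ge> 0" for x :: real
  proof -
    have "(1 - x) * exp x \<le> exp (- x) * exp x"
      using exp_ge_add_one_self[of "- x"] by (intro mult_right_mono) auto
    then show ?thesis by (simp add: exp_minus_inverse mult.commute algebra_simps flip: exp_add)
  qed
  have k_mono: "k x \<le> k y" if "x \<le> y" for x y
    by (rule DERIV_nonneg_imp_nondecreasing[OF that]) (intro exI conjI, rule dk, rule dk_nonneg)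
  have k0: "k 0 = 0" by (simp add: k_def)
  have dg: "(g has_real_derivative 2 / 3 * k x) (at x)" for x
    unfolding g_def k_def
    by (auto intro!: derivative_eq_intros simp: algebra_simps)
  have "g x \<ge> g 0"
  proof (cases "x \<ge> 0")
    case True
    have k_pos: "2 / 3 * k z \<ge> 0" if "z \<ge> 0" for z using k_mono[OF that] k0 by simp
    show ?thesis by (rule DERIV_nonneg_imp_nondecreasing[OF True]) (intro exI conjI, rule dg, rule k_pos)
  next
    case False
    have k_neg: "2 / 3 * k z \<le> 0" if "z \<le> 0" for z using k_mono[OF that] k0 by simp
    show ?thesis by (rule DERIV_nonpos_imp_nonincreasing) (use False in simp, intro exI conjI, rule dg, rule k_neg)
  qed
  then show ?thesis by (simp add: g_def)
qed

text \<open>Since \<open>exp x - 1 - x\<close> is nonnegative, \<open>1 - x / 3\<close> may be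
  replaced by the smaller \<open>1 - c / 3\<close>, which is positive for \<open>c < 3\<close>. A
  one-sided bound on \<open>x\<close> thus suffices.\<close>

lemma exp_le_bernstein:
  fixes x c :: real
  assumes "x \<le> c" and "c < 3"
  shows "exp x \<le> 1 + x + x\<^sup>2 / (2 * (1 - c / 3))"
proof -
  have "2 * (exp x - 1 - x) * (1 - c / 3) \<le> 2 * (exp x - 1 - x) * (1 - x / 3)"
    using assms exp_ge_add_one_self[of x] by (intro mult_left_mono) (auto simp del: exp_ge_add_one_self)
  also have "\<dots> \<le> x\<^sup>2" by (rule bernstein_aux)
  finally have "(exp x - 1 - x) * (2 * (1 - c / 3)) \<le> x\<^sup>2" by (simp only: mult_ac)
  moreover have "2 * (1 - c / 3) > 0" using assms(2) by simp
  ultimately have "exp x - 1 - x \<le> x\<^sup>2 / (2 * (1 - c / 3))"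
    by (simp only: pos_le_divide_eq)
  then show ?thesis by simp
qed

section \<open>Weights, hedge loss and mix loss of a single round\<close>

lemma mem_minimizers: "i \<in> minimizers K L \<longleftrightarrow> i \<in> {1..K} \<and> (\<forall>j\<in>{1..K}. L i \<le> L j)"
  by (auto simp: minimizers_def is_arg_min_linorder)

lemma finite_minimizers: "finite (minimizers K L)"
  by (rule finite_subset[of _ "{1..K}"]) (auto simp: mem_minimizers)

lemma minimizers_nonempty:
  assumes "K \<ge> 1"
  shows "minimizers K L \<noteq> {}"
proof -
  obtain i where "i \<in> {1..K}" "L i = Min (L ` {1..K})"
    using Min_in[of "L ` {1..K}"] assms by fastforce
  then have "i \<in> minimizers K L" by (auto simp: mem_minimizers)
  then show ?thesis by blast
qed

lemma sum_exp_pos: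
  fixes f :: "nat \<Rightarrow> real"
  assumes "K \<ge> 1"
  shows "(\<Sum>i = 1..K. exp (f i)) > 0"
  using assms by (intro sum_pos) auto

lemma hedge_weight_nonneg: "hedge_weight K \<eta> L i \<ge> 0"
  by (auto simp: hedge_weight_def intro!: divide_nonneg_nonneg sum_nonneg)

lemma hedge_weight_sum:
  assumes "K \<ge> 1"
  shows "(\<Sum>i = 1..K. hedge_weight K \<eta> L i) = 1"
proof (cases "\<eta> = \<infinity>")
  case True
  have "{1..K} \<inter> minimizers K L = minimizers K L" by (auto simp: mem_minimizers)
  then have "(\<Sum>i = 1..K. indicator (minimizers K L) i) = real (card (minimizers K L))"
    by (simp add: indicator_def sum.If_cases)
  moreover have "card (minimizers K L) \<noteq> 0"
    using minimizers_nonempty[OF assms] finite_minimizers by auto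
  ultimately show ?thesis using True
    by (simp add: hedge_weight_def flip: sum_divide_distrib)
next
  case False
  then show ?thesis
    using sum_exp_pos[OF assms, of "\<lambda>j. - real_of_ereal \<eta> * L j"]
    by (simp add: hedge_weight_def flip: sum_divide_distrib)
qed

lemma hedge_loss_le:
  assumes "K \<ge> 1" and "\<And>i. i \<in> {1..K} \<Longrightarrow> l i \<le> c"
  shows "hedge_loss K \<eta> L l \<le> c"
proof -
  have "hedge_loss K \<eta> L l \<le> (\<Sum>i = 1..K. hedge_weight K \<eta> L i * c)"
    unfolding hedge_loss_def
    by (intro sum_mono mult_left_mono assms(2) hedge_weight_nonneg)
  also have "\<dots> = c" unfolding sum_distrib_right[symmetric] hedge_weight_sum[OF assms(1)] by simp
  finally show ?thesis .
qed

lemma sum_hedge_weight_exp_pos: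
  assumes "K \<ge> 1" and "0 < r"
  shows "(\<Sum>i = 1..K. hedge_weight K (ereal r) L i * exp (f i)) > 0"
  using assms sum_exp_pos[OF assms(1), of "\<lambda>j. - r * L j"]
  by (intro sum_pos) (auto simp: hedge_weight_def)

text \<open>Removes the logarithm: bounds on the mix loss become bounds on exponential means,
  centred at a freely chosen \<open>c\<close>, such as a lower bound of the losses, the hedge loss
  or a mix loss at another rate.\<close>

lemma exp_mix_loss:
  assumes "K \<ge> 1" and "0 < r"
  shows "exp (r * (c - mix_loss K (ereal r) L l))
    = (\<Sum>i = 1..K. hedge_weight K (ereal r) L i * exp (r * (c - l i)))"
proof -
  have "exp (r * (c - mix_loss K (ereal r) L l))
      = exp (r * c + ln (\<Sum>i = 1..K. hedge_weight K (ereal r) L i * exp (- r * l i)))"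
    using assms(2) by (simp add: mix_loss_def field_simps)
  also have "\<dots> = exp (r * c) * (\<Sum>i = 1..K. hedge_weight K (ereal r) L i * exp (- r * l i))"
    using sum_hedge_weight_exp_pos[OF assms, of L "\<lambda>i. - r * l i"] by (simp add: exp_add)
  also have "\<dots> = (\<Sum>i = 1..K. hedge_weight K (ereal r) L i * exp (r * (c - l i)))"
    by (simp add: sum_distrib_left right_diff_distrib exp_diff exp_minus field_simps)
  finally show ?thesis .
qed

lemma mix_loss_ge:
  assumes "K \<ge> 1" and "0 < \<eta>" and "\<And>i. i \<in> {1..K} \<Longrightarrow> c \<le> l i"
  shows "c \<le> mix_loss K \<eta> L l"
proof (cases \<eta>)
  case (real r)
  then have r: "r > 0" using assms by simp
  have "exp (r * (c - mix_loss K (ereal r) L l))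
      \<le> (\<Sum>i = 1..K. hedge_weight K (ereal r) L i * 1)"
    unfolding exp_mix_loss[OF assms(1) r] using assms(3) r
    by (intro sum_mono mult_left_mono hedge_weight_nonneg) (auto simp: mult_nonneg_nonpos)
  also have "\<dots> = 1" using hedge_weight_sum[OF assms(1)] by simp
  finally show ?thesis using r real by (simp add: mult_le_0_iff)
next
  case PInf
  obtain i where i: "i \<in> {1..K}" "L i + l i = (MIN i\<in>{1..K}. L i + l i)"
    using Min_in[of "(\<lambda>i. L i + l i) ` {1..K}"] assms(1) by fastforce
  have "(MIN i\<in>{1..K}. L i) \<le> L i" using i(1) by (intro Min_le) auto
  moreover have "c \<le> l i" using i assms by blast
  ultimately have "c \<le> (MIN i\<in>{1..K}. L i + l i) - (MIN i\<in>{1..K}. L i)" using i(2) by linarith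
  then show ?thesis using PInf by (simp add: mix_loss_def)
qed (use assms in auto)

text \<open>Jensen's inequality. At a finite rate it is \<open>1 + x \<le> exp x\<close>, centred at
  the hedge loss so that the linear term averages to zero. At an infinite rate all weight sits on
  the leaders, and the minimum grows by at most the loss of any leader.\<close>

lemma mix_loss_le_hedge_loss:
  assumes "K \<ge> 1" and "0 < \<eta>"
  shows "mix_loss K \<eta> L l \<le> hedge_loss K \<eta> L l"
proof (cases \<eta>)
  case (real r)
  then have r: "r > 0" using assms by simp
  let ?h = "hedge_loss K (ereal r) L l"
  have "1 = (\<Sum>i = 1..K. hedge_weight K (ereal r) L i * (1 + r * (?h - l i)))"
    using hedge_weight_sum[OF assms(1), of "ereal r" L]
    by (simp add: algebra_simps sum.distrib sum_subtractf hedge_loss_def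
        flip: sum_distrib_left sum_distrib_right)
  also have "\<dots> \<le> exp (r * (?h - mix_loss K (ereal r) L l))"
    unfolding exp_mix_loss[OF assms(1) r]
    by (intro sum_mono mult_left_mono hedge_weight_nonneg) (rule exp_ge_add_one_self)
  finally show ?thesis using r real by (simp add: zero_le_mult_iff)
next
  case PInf
  have L: "L i = (MIN i\<in>{1..K}. L i)" if "i \<in> minimizers K L" for i
    using that by (intro Min_eqI[symmetric]) (auto simp: mem_minimizers)
  let ?m = "mix_loss K \<infinity> L l"
  have le: "hedge_weight K \<infinity> L i * ?m \<le> hedge_weight K \<infinity> L i * l i" if "i \<in> {1..K}" for i
  proof (cases "i \<in> minimizers K L")
    case True
    have "(MIN i\<in>{1..K}. L i + l i) \<le> L i + l i" using that by (intro Min_le) auto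
    then show ?thesis using L[OF True]
      by (intro mult_left_mono hedge_weight_nonneg) (simp add: mix_loss_def)
  qed (simp add: hedge_weight_def)
  have "?m = (\<Sum>i = 1..K. hedge_weight K \<infinity> L i * ?m)"
    using hedge_weight_sum[OF assms(1)] by (simp flip: sum_distrib_right)
  also have "\<dots> \<le> hedge_loss K \<infinity> L l" unfolding hedge_loss_def by (intro sum_mono le)
  finally show ?thesis using PInf by simp
qed (use assms in auto)

text \<open>
  Since weights at zero cumulative loss are uniform, \<open>mix_loss K \<eta> (\<lambda>_. 0) L\<close> is the
  potential \<open>- ln ((\<Sum>i. exp (- \<eta> * L i)) / K) / \<eta>\<close>, and it equals \<open>MIN i. L i\<close>
  for \<open>\<eta> = \<infinity>\<close>.
\<close>

lemma mix_loss_zero_real: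
  assumes "K \<ge> 1"
  shows "mix_loss K (ereal r) (\<lambda>_. 0) L = - ln ((\<Sum>i = 1..K. exp (- r * L i)) / K) / r"
  using assms by (simp add: mix_loss_def hedge_weight_def flip: sum_divide_distrib)

text \<open>Lets the mix losses telescope at a fixed rate. The denominator of the weights is the
  exponential sum before the round, the numerator becomes the one after it, and \<open>ln\<close>
  turns the quotient into a difference.\<close>

lemma mix_loss_chain:
  assumes "K \<ge> 1" and "0 < \<eta>"
  shows "mix_loss K \<eta> L l
    = mix_loss K \<eta> (\<lambda>_. 0) (\<lambda>i. L i + l i) - mix_loss K \<eta> (\<lambda>_. 0) L"
proof (cases \<eta>)
  case (real r)
  then have r: "r > 0" using assms by simp
  let ?A = "\<Sum>i = 1..K. exp (- r * (L i + l i))" and ?B = "\<Sum>i = 1..K. exp (- r * L i)"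
  have pos: "?A > 0" "?B > 0" by (rule sum_exp_pos[OF assms(1)])+
  have "(\<Sum>i = 1..K. hedge_weight K (ereal r) L i * exp (- r * l i)) = ?A / ?B"
    by (simp add: hedge_weight_def sum_divide_distrib right_diff_distrib exp_diff exp_minus field_simps)
  then have "mix_loss K \<eta> L l = - (1 / r) * (ln ?A - ln ?B)"
    using pos real by (simp add: mix_loss_def ln_div)
  also have "\<dots> = (ln ?B - ln ?A) / r" by (simp add: divide_inverse right_diff_distrib mult.commute)
  finally have "mix_loss K \<eta> L l = (ln ?B - ln ?A) / r" .
  then show ?thesis using pos real assms
    unfolding real mix_loss_zero_real[OF assms(1)] by (simp add: ln_div flip: diff_divide_distrib)
next
  case PInf
  have "{1..K} \<noteq> {}" using assms by auto
  then show ?thesis using PInf by (simp add: mix_loss_def)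
qed (use assms in auto)

text \<open>Monotonicity of power means: the weights are uniform at both rates, so only the exponent
  changes. At an infinite rate the potential is the minimum, which bounds every mix loss from
  below.\<close>

lemma mix_loss_zero_antimono:
  assumes "K \<ge> 1" and "0 < \<eta>" and "\<eta> \<le> \<eta>'"
  shows "mix_loss K \<eta>' (\<lambda>_. 0) L \<le> mix_loss K \<eta> (\<lambda>_. 0) L"
proof (cases \<eta>')
  case (real s)
  with assms obtain r where r: "\<eta> = ereal r" "0 < r" "r \<le> s" by (cases \<eta>) auto
  let ?m = "mix_loss K (ereal r) (\<lambda>_. 0) L"
  let ?w = "hedge_weight K (ereal r) (\<lambda>_. 0)"
  have w: "?w = hedge_weight K (ereal s) (\<lambda>_. 0)" by (auto simp: hedge_weight_def)
  \<comment> \<open>Bernoulli's inequality for the power \<open>s / r\<close> of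
    \<open>exp (r * z)\<close>, from convexity of \<open>exp\<close> between 0 and
    \<open>s * z\<close>.\<close>
  have bern: "1 + s / r * (exp (r * z) - 1) \<le> exp (s * z)" for z
  proof -
    have "exp ((1 - r / s) *\<^sub>R 0 + (r / s) *\<^sub>R (s * z)) \<le> (1 - r / s) * exp 0 + r / s * exp (s * z)"
      by (rule convex_onD[OF exp_convex]) (use r in auto)
    then have "s / r * exp (r * z) \<le> s / r * (1 - r / s + r / s * exp (s * z))"
      using r by (intro mult_left_mono) auto
    also have "\<dots> = s / r - 1 + exp (s * z)" using r by (simp add: distrib_left right_diff_distrib)
    finally show ?thesis by (simp add: algebra_simps)
  qed
  \<comment> \<open>Centred at \<open>?m\<close>, the exponential mean at rate \<open>r\<close> is
    exactly 1, so averaging \<open>bern\<close> shows that the mean at rate \<open>s\<close> is at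
    least 1.\<close>
  have "1 = 1 + s / r * (exp (r * (?m - ?m)) - 1)" by simp
  also have "\<dots> = (\<Sum>i = 1..K. ?w i * (1 + s / r * (exp (r * (?m - L i)) - 1)))"
  proof -
    have "(\<Sum>i = 1..K. ?w i * (1 + s / r * (exp (r * (?m - L i)) - 1)))
        = (\<Sum>i = 1..K. ?w i * (1 - s / r) + s / r * (?w i * exp (r * (?m - L i))))"
      by (intro sum.cong refl) (simp add: algebra_simps)
    also have "\<dots> = 1 - s / r + s / r * exp (r * (?m - ?m))"
      unfolding exp_mix_loss[OF assms(1) r(2)] sum.distrib sum_distrib_left[symmetric]
        sum_distrib_right[symmetric] hedge_weight_sum[OF assms(1)] by simp
    finally show ?thesis by simp
  qed
  also have "\<dots> \<le> (\<Sum>i = 1..K. ?w i * exp (s * (?m - L i)))"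
    by (intro sum_mono mult_left_mono hedge_weight_nonneg bern)
  also have "\<dots> = exp (s * (?m - mix_loss K (ereal s) (\<lambda>_. 0) L))"
    using exp_mix_loss[OF assms(1), of s ?m "\<lambda>_. 0" L] r w by simp
  finally show ?thesis using r real by (simp add: zero_le_mult_iff)
next
  case PInf
  have "mix_loss K \<infinity> (\<lambda>_. 0) L = (MIN i\<in>{1..K}. L i)"
    using assms by (simp add: mix_loss_def)
  also have "\<dots> \<le> mix_loss K \<eta> (\<lambda>_. 0) L"
    by (rule mix_loss_ge) (use assms in \<open>auto intro: Min_le\<close>)
  finally show ?thesis using PInf by simp
qed (use assms in auto)

text \<open>Keeping only the term of expert \<open>i\<close> in the sum costs
  \<open>ln K / r\<close>, the price of the uniform prior.\<close>

lemma mix_loss_zero_le: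
  assumes "K \<ge> 1" and "0 < r" and "i \<in> {1..K}"
  shows "mix_loss K (ereal r) (\<lambda>_. 0) L \<le> L i + ln K / r"
proof -
  have "exp (- r * L i) \<le> (\<Sum>i = 1..K. exp (- r * L i))"
    using assms(3) by (intro member_le_sum) auto
  then have "ln (exp (- r * L i)) \<le> ln (\<Sum>i = 1..K. exp (- r * L i))"
    by (subst ln_le_cancel_iff) (use sum_exp_pos[OF assms(1)] in auto)
  then have "- ln (\<Sum>i = 1..K. exp (- r * L i)) / r \<le> r * L i / r"
    using assms(2) by (intro divide_right_mono) auto
  then show ?thesis
    unfolding mix_loss_zero_real[OF assms(1)]
    using assms sum_exp_pos[OF assms(1), of "\<lambda>i. - r * L i"]
    by (simp add: ln_div diff_divide_distrib)
qed

section \<open>Variance and mixability gap\<close>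

definition hedge_var :: "nat \<Rightarrow> ereal \<Rightarrow> (nat \<Rightarrow> real) \<Rightarrow> (nat \<Rightarrow> real) \<Rightarrow> real" where
  "hedge_var K \<eta> L l = (\<Sum>i = 1..K. hedge_weight K \<eta> L i * (l i - hedge_loss K \<eta> L l)\<^sup>2)"

lemma hedge_var_nonneg: "hedge_var K \<eta> L l \<ge> 0"
  by (auto simp: hedge_var_def intro!: sum_nonneg mult_nonneg_nonneg hedge_weight_nonneg)

text \<open>On [0, 1] a square is at most the value itself, so the second moment is at most the
  mean.\<close>

lemma hedge_var_le:
  assumes "K \<ge> 1" and "\<And>i. i \<in> {1..K} \<Longrightarrow> l i \<in> {0..1}"
  shows "hedge_var K \<eta> L l \<le> hedge_loss K \<eta> L l * (1 - hedge_loss K \<eta> L l)"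
proof -
  let ?w = "hedge_weight K \<eta> L" and ?h = "hedge_loss K \<eta> L l"
  have "hedge_var K \<eta> L l \<le> (\<Sum>i = 1..K. ?w i * (l i * (1 - 2 * ?h) + ?h\<^sup>2))"
    unfolding hedge_var_def
  proof (intro sum_mono mult_left_mono hedge_weight_nonneg)
    fix i assume "i \<in> {1..K}"
    then have "l i * l i \<le> l i * 1" using assms(2) by (intro mult_left_mono) auto
    then show "(l i - ?h)\<^sup>2 \<le> l i * (1 - 2 * ?h) + ?h\<^sup>2"
      by (simp add: power2_eq_square algebra_simps)
  qed
  also have "\<dots> = (\<Sum>i = 1..K. ?w i * l i) * (1 - 2 * ?h) + (\<Sum>i = 1..K. ?w i) * ?h\<^sup>2"
    by (simp add: distrib_left sum.distrib sum_distrib_right mult.assoc)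
  also have "\<dots> = ?h * (1 - ?h)"
    unfolding hedge_weight_sum[OF assms(1)] hedge_loss_def[symmetric]
    by (simp add: power2_eq_square algebra_simps)
  finally show ?thesis .
qed

text \<open>Having \<open>d\<close> on both sides avoids a denominator \<open>1 - r / 3\<close> and
  covers every rate: for \<open>r \<ge> 3\<close> already \<open>d \<le> r * (d / 3)\<close>. For
  \<open>r < 3\<close> the linear term of \<open>exp_le_bernstein\<close> averages to zero and the
  quadratic one yields the variance.\<close>

lemma mixability_gap_bernstein:
  fixes L l :: "nat \<Rightarrow> real"
  assumes "K \<ge> 1" and "0 < r" and "\<And>i. i \<in> {1..K} \<Longrightarrow> l i \<in> {0..1}"
  defines "d \<equiv> hedge_loss K (ereal r) L l - mix_loss K (ereal r) L l"
  shows "d \<le> r * (hedge_var K (ereal r) L l / 2 + d / 3)"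
proof (cases "r < 3")
  case True
  let ?w = "hedge_weight K (ereal r) L" and ?h = "hedge_loss K (ereal r) L l"
  let ?v = "hedge_var K (ereal r) L l"
  have h1: "?h \<le> 1" by (rule hedge_loss_le) (use assms in auto)
  define c where "c = 2 * (1 - r / 3)"
  have c: "c > 0" using True by (simp add: c_def)
  have "exp (r * d) = (\<Sum>i = 1..K. ?w i * exp (r * (?h - l i)))"
    unfolding d_def by (rule exp_mix_loss[OF assms(1,2)])
  also have "\<dots> \<le> (\<Sum>i = 1..K. ?w i * (1 + r * (?h - l i) + (r * (?h - l i))\<^sup>2 / c))"
    unfolding c_def
  proof (intro sum_mono mult_left_mono hedge_weight_nonneg exp_le_bernstein True)
    fix i assume "i \<in> {1..K}"
    then have "?h - l i \<le> 1" using h1 assms(3)[of i] by auto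
    then have "r * (?h - l i) \<le> r * 1" using assms(2) by (intro mult_left_mono) auto
    then show "r * (?h - l i) \<le> r" by simp
  qed
  also have "\<dots> = (\<Sum>i = 1..K. ?w i * (1 + r * ?h) - r * (?w i * l i)
      + r\<^sup>2 / c * (?w i * (l i - ?h)\<^sup>2))"
  proof (intro sum.cong refl)
    fix i
    have "(r * (?h - l i))\<^sup>2 = r\<^sup>2 * (l i - ?h)\<^sup>2"
      by (simp only: power_mult_distrib power2_commute)
    then show "?w i * (1 + r * (?h - l i) + (r * (?h - l i))\<^sup>2 / c)
      = ?w i * (1 + r * ?h) - r * (?w i * l i) + r\<^sup>2 / c * (?w i * (l i - ?h)\<^sup>2)"
      by (simp add: algebra_simps)
  qed
  also have "\<dots> = 1 + r\<^sup>2 / c * ?v"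
    unfolding sum.distrib sum_subtractf sum_distrib_left[symmetric] sum_distrib_right[symmetric]
      hedge_weight_sum[OF assms(1)] hedge_var_def[symmetric]
    unfolding hedge_loss_def[symmetric] by simp
  also have "\<dots> \<le> exp (r\<^sup>2 / c * ?v)" by (rule exp_ge_add_one_self)
  finally have "r * d \<le> r * (r * ?v / c)" by (simp add: power2_eq_square)
  then have "d \<le> r * ?v / c" using assms(2) by (simp only: mult_le_cancel_left_pos)
  then have "d * c \<le> r * ?v" using c by (simp add: pos_le_divide_eq)
  then show ?thesis by (simp add: c_def algebra_simps)
next
  case False
  have "d \<ge> 0" unfolding d_def using mix_loss_le_hedge_loss[of K "ereal r" L l] assms(1,2) by simp
  then have "3 * (d / 3) \<le> r * (d / 3)" using False by (intro mult_right_mono) auto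
  moreover have "0 \<le> r * (hedge_var K (ereal r) L l / 2)"
    using hedge_var_nonneg assms(2) by simp
  ultimately show ?thesis by (simp add: distrib_left)
qed

section \<open>AdaHedge over all rounds\<close>

lemma adahedge_gap_one: "adahedge_gap 1 l t = 0"
proof (induction t)
  case (Suc t)
  have "minimizers 1 (cum_loss l t) = {1}" by (auto simp: mem_minimizers)
  then show ?case using Suc
    by (simp add: adahedge_rate_def hedge_loss_def mix_loss_def hedge_weight_def)
qed simp

text \<open>A single expert needs care: \<open>ln K = 0\<close> would give rate 0 at a nonzero gap,
  but then the gap stays 0 and the rate infinite.\<close>

lemma adahedge_rate_pos:
  assumes "K \<ge> 1" and "adahedge_gap K l t \<ge> 0"
  shows "adahedge_rate K (adahedge_gap K l t) > 0"
proof (cases "K = 1")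
  case True
  then show ?thesis using adahedge_gap_one[of l t] by (simp add: adahedge_rate_def)
next
  case False
  then show ?thesis using assms by (simp add: adahedge_rate_def)
qed

lemma adahedge_gap_step:
  assumes "K \<ge> 1" and "adahedge_gap K l t \<ge> 0"
  shows "adahedge_gap K l t \<le> adahedge_gap K l (Suc t)"
  using mix_loss_le_hedge_loss[OF assms(1) adahedge_rate_pos[OF assms]] by (simp add: Let_def)

lemma adahedge_gap_nonneg:
  assumes "K \<ge> 1"
  shows "adahedge_gap K l t \<ge> 0"
proof (induction t)
  case (Suc t)
  then show ?case using adahedge_gap_step[OF assms Suc] by linarith
qed simp

lemma cum_loss_Suc: "cum_loss l (Suc t) = (\<lambda>i. cum_loss l t i + l (Suc t) i)"
  by (auto simp: cum_loss_def)

definition adahedge_loss :: "nat \<Rightarrow> (nat \<Rightarrow> nat \<Rightarrow> real) \<Rightarrow> nat \<Rightarrow> real" where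
  "adahedge_loss K l t = hedge_loss K (adahedge_rate K (adahedge_gap K l (t - 1))) (cum_loss l (t - 1)) (l t)"

definition adahedge_var :: "nat \<Rightarrow> (nat \<Rightarrow> nat \<Rightarrow> real) \<Rightarrow> nat \<Rightarrow> real" where
  "adahedge_var K l t = hedge_var K (adahedge_rate K (adahedge_gap K l (t - 1))) (cum_loss l (t - 1)) (l t)"

text \<open>The left side is the cumulative mix loss, as the gap sums hedge loss minus mix loss.
  Each round advances the potential at the current rate; the subsequent drop of the rate can only
  raise it.\<close>

lemma adahedge_cum_mix_loss_le:
  assumes "K \<ge> 1"
  shows "(\<Sum>t = 1..n. adahedge_loss K l t) - adahedge_gap K l n
    \<le> mix_loss K (adahedge_rate K (adahedge_gap K l n)) (\<lambda>_. 0) (cum_loss l n)"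
proof (induction n)
  case 0
  have "{1..K} \<noteq> {}" using assms by auto
  then show ?case by (simp add: adahedge_rate_def mix_loss_def cum_loss_def)
next
  case (Suc n)
  let ?\<Delta> = "adahedge_gap K l n"
  let ?\<eta> = "adahedge_rate K ?\<Delta>" and ?\<eta>' = "adahedge_rate K (adahedge_gap K l (Suc n))"
  let ?\<Phi> = "\<lambda>\<eta> n. mix_loss K \<eta> (\<lambda>_. 0) (cum_loss l n)"
  note pos = adahedge_rate_pos[OF assms adahedge_gap_nonneg[OF assms]]
  have rate: "?\<eta>' \<le> ?\<eta>"
  proof (cases "?\<Delta> = 0")
    case False
    then have "0 < ?\<Delta>" "?\<Delta> \<le> adahedge_gap K l (Suc n)"
      using adahedge_gap_nonneg[OF assms] adahedge_gap_step[OF assms] by (auto simp: order_less_le)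
    then show ?thesis using assms unfolding adahedge_rate_def
      by (auto intro!: divide_left_mono)
  qed (simp add: adahedge_rate_def)
  have "(\<Sum>t = 1..Suc n. adahedge_loss K l t) - adahedge_gap K l (Suc n)
      = (\<Sum>t = 1..n. adahedge_loss K l t) - ?\<Delta> + mix_loss K ?\<eta> (cum_loss l n) (l (Suc n))"
    by (simp add: Let_def adahedge_loss_def)
  also have "\<dots> \<le> ?\<Phi> ?\<eta> n + mix_loss K ?\<eta> (cum_loss l n) (l (Suc n))"
    using Suc by simp
  also have "\<dots> = ?\<Phi> ?\<eta> (Suc n)"
    unfolding cum_loss_Suc using mix_loss_chain[of K ?\<eta> "cum_loss l n" "l (Suc n)", OF assms pos] by simp
  also have "\<dots> \<le> ?\<Phi> ?\<eta>' (Suc n)"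
    by (rule mix_loss_zero_antimono[OF assms pos rate])
  finally show ?case .
qed

text \<open>The rate is tuned so that the price \<open>ln K / \<eta>\<close> of the prior equals the
  gap. The second gap comes from passing from mix losses to hedge losses.\<close>

lemma adahedge_regret_le_gap:
  assumes "K \<ge> 1" and "i \<in> {1..K}"
  shows "(\<Sum>t = 1..n. adahedge_loss K l t) \<le> cum_loss l n i + 2 * adahedge_gap K l n"
proof -
  let ?\<Delta> = "adahedge_gap K l n"
  have "mix_loss K (adahedge_rate K ?\<Delta>) (\<lambda>_. 0) (cum_loss l n) \<le> cum_loss l n i + ?\<Delta>"
  proof (cases "?\<Delta> = 0")
    case True
    have "(MIN i\<in>{1..K}. cum_loss l n i) \<le> cum_loss l n i" using assms(2) by (intro Min_le) auto
    then show ?thesis using True assms(1) by (simp add: adahedge_rate_def mix_loss_def)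
  next
    case False
    then have pos: "?\<Delta> > 0" using adahedge_gap_nonneg[OF assms(1)] by (simp add: order_less_le)
    have K: "ln K > 0" using assms(1) False adahedge_gap_one[of l n] by (cases "K = 1") auto
    then show ?thesis
      using mix_loss_zero_le[OF assms(1) _ assms(2), of "ln K / ?\<Delta>" "cum_loss l n"] pos
      by (simp add: adahedge_rate_def)
  qed
  then show ?thesis using adahedge_cum_mix_loss_le[OF assms(1), of l n] by linarith
qed

lemma adahedge_gap_square:
  assumes "K \<ge> 1" and "\<And>t i. t \<in> {1..n} \<Longrightarrow> i \<in> {1..K} \<Longrightarrow> l t i \<in> {0..1}"
  shows "(adahedge_gap K l n)\<^sup>2
    \<le> ln K * (\<Sum>t = 1..n. adahedge_var K l t) + (2 / 3 * ln K + 1) * adahedge_gap K l n"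
  using assms(2)
proof (induction n)
  case 0
  then show ?case by simp
next
  case (Suc n)
  let ?\<Delta> = "adahedge_gap K l n"
  let ?\<eta> = "adahedge_rate K ?\<Delta>" and ?L = "cum_loss l n" and ?l = "l (Suc n)"
  define d where "d = hedge_loss K ?\<eta> ?L ?l - mix_loss K ?\<eta> ?L ?l"
  note pos = adahedge_rate_pos[OF assms(1) adahedge_gap_nonneg[OF assms(1)]]
  have l: "?l i \<in> {0..1}" if "i \<in> {1..K}" for i using Suc.prems that by simp
  have d0: "d \<ge> 0" unfolding d_def using mix_loss_le_hedge_loss[OF assms(1) pos] by simp
  have "hedge_loss K ?\<eta> ?L ?l \<le> 1" using l by (intro hedge_loss_le assms(1)) auto
  moreover have "mix_loss K ?\<eta> ?L ?l \<ge> 0" using l by (intro mix_loss_ge assms(1) pos) auto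
  ultimately have d1: "d \<le> 1" by (simp add: d_def)
  have step: "adahedge_gap K l (Suc n) = ?\<Delta> + d" by (simp add: Let_def d_def)
  have v: "adahedge_var K l (Suc n) = hedge_var K ?\<eta> ?L ?l" by (simp add: adahedge_var_def)
  \<comment> \<open>For a positive gap this is the Bernstein bound at rate
    \<open>ln K / \<Delta>\<close>, multiplied by \<open>2 * \<Delta>\<close>. With
    \<open>d * d \<le> d\<close> it controls the increment \<open>2 * \<Delta> * d + d * d\<close>
    of the squared gap.\<close>
  have main: "2 * ?\<Delta> * d \<le> ln K * (adahedge_var K l (Suc n) + 2 / 3 * d)"
  proof (cases "?\<Delta> = 0")
    case True
    then show ?thesis using d0 assms(1) hedge_var_nonneg by (simp add: v)
  next
    case False
    then have \<Delta>: "?\<Delta> > 0" using adahedge_gap_nonneg[OF assms(1)] by (simp add: order_less_le)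
    have K: "ln K > 0" using assms(1) False adahedge_gap_one[of l n] by (cases "K = 1") auto
    have \<eta>: "?\<eta> = ereal (ln K / ?\<Delta>)" using False by (simp add: adahedge_rate_def)
    have "d \<le> ln K / ?\<Delta> * (adahedge_var K l (Suc n) / 2 + d / 3)"
      unfolding d_def v \<eta> by (rule mixability_gap_bernstein) (use assms(1) \<Delta> K l in auto)
    then show ?thesis using \<Delta> by (simp add: field_simps)
  qed
  have "d * d \<le> d * 1" using d0 d1 by (intro mult_left_mono) auto
  moreover have "?\<Delta>\<^sup>2 \<le> ln K * (\<Sum>t = 1..n. adahedge_var K l t) + (2 / 3 * ln K + 1) * ?\<Delta>"
    using Suc by simp
  ultimately show ?case using main
    unfolding step by (simp add: power2_eq_square algebra_simps add_divide_distrib)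
qed

lemma adahedge_regret:
  assumes "K \<ge> 1" and "\<And>t i. t \<in> {1..n} \<Longrightarrow> i \<in> {1..K} \<Longrightarrow> l t i \<in> {0..1}"
    and "i \<in> {1..K}"
  shows "(\<Sum>t = 1..n. adahedge_loss K l t) \<le> cum_loss l n i
    + 2 * sqrt (ln K * (\<Sum>t = 1..n. adahedge_var K l t)) + 4 / 3 * ln K + 2"
proof -
  let ?\<Delta> = "adahedge_gap K l n"
  define c where "c = 2 / 3 * ln K + 1"
  define s where "s = sqrt (ln K * (\<Sum>t = 1..n. adahedge_var K l t))"
  have V: "(\<Sum>t = 1..n. adahedge_var K l t) \<ge> 0"
    by (auto intro!: sum_nonneg simp: adahedge_var_def hedge_var_nonneg)
  have s: "s \<ge> 0" "s\<^sup>2 = ln K * (\<Sum>t = 1..n. adahedge_var K l t)"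
    using V assms(1) by (auto simp: s_def)
  have c: "c > 0" using assms(1) by (simp add: c_def add_nonneg_pos)
  have sq: "?\<Delta>\<^sup>2 \<le> s\<^sup>2 + c * ?\<Delta>"
    using adahedge_gap_square[of K n l] assms(1,2) unfolding s c_def by simp
  \<comment> \<open>Solves the quadratic inequality \<open>sq\<close>: beyond \<open>s + c\<close>
    the product \<open>(\<Delta> - c) * \<Delta>\<close> would exceed \<open>s * s\<close>.\<close>
  have "?\<Delta> \<le> s + c"
  proof (rule ccontr)
    assume "\<not> ?\<Delta> \<le> s + c"
    then have "s < ?\<Delta> - c" "s < ?\<Delta>" using c by auto
    then have "s * s < (?\<Delta> - c) * ?\<Delta>" using s(1) by (intro mult_strict_mono') auto
    then show False using sq by (simp add: power2_eq_square algebra_simps)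
  qed
  then show ?thesis
    using adahedge_regret_le_gap[OF assms(1,3), of l n] by (simp add: s_def c_def)
qed

section \<open>Measurability\<close>

lemma borel_measurable_hedge_weight:
  assumes r: "r \<in> borel_measurable N"
    and L: "\<And>i. i \<in> {1..K} \<Longrightarrow> (\<lambda>\<omega>. L \<omega> i) \<in> borel_measurable N"
    and i: "i \<in> {1..K}"
  shows "(\<lambda>\<omega>. hedge_weight K (adahedge_rate K (r \<omega>)) (L \<omega>) i) \<in> borel_measurable N"
proof -
  \<comment> \<open>Being a minimizer is a finite conjunction of comparisons; the cardinality is
    then a finite sum of measurable indicators.\<close>
  have ind: "(\<lambda>\<omega>. indicator (minimizers K (L \<omega>)) j :: real) \<in> borel_measurable N" if "j \<in> {1..K}" for j
  proof -
    have "(\<lambda>\<omega>. if \<forall>k\<in>{1..K}. L \<omega> j \<le> L \<omega> k then 1 else 0 :: real) \<in> borel_measurable N"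
      using L that by measurable
    also have "(\<lambda>\<omega>. if \<forall>k\<in>{1..K}. L \<omega> j \<le> L \<omega> k then 1 else 0 :: real)
        = (\<lambda>\<omega>. indicator (minimizers K (L \<omega>)) j)"
      using that by (auto simp: indicator_def mem_minimizers)
    finally show ?thesis .
  qed
  have card: "real (card (minimizers K (L \<omega>))) = (\<Sum>j = 1..K. indicator (minimizers K (L \<omega>)) j)" for \<omega>
  proof -
    have "{1..K} \<inter> minimizers K (L \<omega>) = minimizers K (L \<omega>)" by (auto simp: mem_minimizers)
    then show ?thesis by (simp add: indicator_def sum.If_cases)
  qed
  \<comment> \<open>Splitting on \<open>r \<omega> = 0\<close> replaces the extended-real rate by
    real expressions.\<close>
  have "(\<lambda>\<omega>. if r \<omega> = 0
      then indicator (minimizers K (L \<omega>)) i / (\<Sum>j = 1..K. indicator (minimizers K (L \<omega>)) j)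
      else exp (- (ln K / r \<omega>) * L \<omega> i) / (\<Sum>j = 1..K. exp (- (ln K / r \<omega>) * L \<omega> j)))
    \<in> borel_measurable N"
    using r L i ind by measurable
  also have "(\<lambda>\<omega>. if r \<omega> = 0
      then indicator (minimizers K (L \<omega>)) i / (\<Sum>j = 1..K. indicator (minimizers K (L \<omega>)) j)
      else exp (- (ln K / r \<omega>) * L \<omega> i) / (\<Sum>j = 1..K. exp (- (ln K / r \<omega>) * L \<omega> j)))
    = (\<lambda>\<omega>. hedge_weight K (adahedge_rate K (r \<omega>)) (L \<omega>) i)"
    by (auto simp: hedge_weight_def adahedge_rate_def card)
  finally show ?thesis .
qed

lemma borel_measurable_cum_loss:
  assumes "\<And>s. s \<in> {1..t} \<Longrightarrow> (\<lambda>\<omega>. l \<omega> s i) \<in> borel_measurable N"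
  shows "(\<lambda>\<omega>. cum_loss (l \<omega>) t i) \<in> borel_measurable N"
  unfolding cum_loss_def using assms by (rule borel_measurable_sum)

lemma borel_measurable_adahedge_gap:
  assumes "\<And>s i. s \<in> {1..t} \<Longrightarrow> i \<in> {1..K} \<Longrightarrow> (\<lambda>\<omega>. l \<omega> s i) \<in> borel_measurable N"
  shows "(\<lambda>\<omega>. adahedge_gap K (l \<omega>) t) \<in> borel_measurable N"
  using assms
proof (induction t)
  case (Suc t)
  let ?r = "\<lambda>\<omega>. adahedge_gap K (l \<omega>) t" and ?L = "\<lambda>\<omega>. cum_loss (l \<omega>) t"
  have r: "?r \<in> borel_measurable N" by (rule Suc.IH) (use Suc.prems in auto)
  have l: "(\<lambda>\<omega>. l \<omega> (Suc t) i) \<in> borel_measurable N" if "i \<in> {1..K}" for i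
    using Suc.prems[of "Suc t" i] that by simp
  have L: "(\<lambda>\<omega>. ?L \<omega> i) \<in> borel_measurable N" if "i \<in> {1..K}" for i
    by (rule borel_measurable_cum_loss) (use Suc.prems that in auto)
  note w = borel_measurable_hedge_weight[of ?r N K ?L, OF r L]
  have h: "(\<lambda>\<omega>. hedge_loss K (adahedge_rate K (?r \<omega>)) (?L \<omega>) (l \<omega> (Suc t))) \<in> borel_measurable N"
    unfolding hedge_loss_def by (intro borel_measurable_sum borel_measurable_times w l)
  have "(\<lambda>\<omega>. if ?r \<omega> = 0
      then Min ((\<lambda>i. ?L \<omega> i + l \<omega> (Suc t) i) ` {1..K}) - Min ((\<lambda>i. ?L \<omega> i) ` {1..K})
      else - (1 / (ln K / ?r \<omega>)) * ln (\<Sum>i = 1..K. hedge_weight K (adahedge_rate K (?r \<omega>)) (?L \<omega>) i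
        * exp (- (ln K / ?r \<omega>) * l \<omega> (Suc t) i))) \<in> borel_measurable N"
    using r L l w by measurable
  also have "(\<lambda>\<omega>. if ?r \<omega> = 0
      then Min ((\<lambda>i. ?L \<omega> i + l \<omega> (Suc t) i) ` {1..K}) - Min ((\<lambda>i. ?L \<omega> i) ` {1..K})
      else - (1 / (ln K / ?r \<omega>)) * ln (\<Sum>i = 1..K. hedge_weight K (adahedge_rate K (?r \<omega>)) (?L \<omega>) i
        * exp (- (ln K / ?r \<omega>) * l \<omega> (Suc t) i)))
      = (\<lambda>\<omega>. mix_loss K (adahedge_rate K (?r \<omega>)) (?L \<omega>) (l \<omega> (Suc t)))"
    by (auto simp: mix_loss_def adahedge_rate_def)
  finally have "(\<lambda>\<omega>. mix_loss K (adahedge_rate K (?r \<omega>)) (?L \<omega>) (l \<omega> (Suc t)))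
    \<in> borel_measurable N" .
  then show ?case unfolding adahedge_gap.simps Let_def
    by (intro borel_measurable_diff borel_measurable_add r h)
qed simp

text \<open>Only rounds before \<open>t\<close> enter, so the weights are determined by the past
  when the action of round \<open>t\<close> is drawn.\<close>

lemma borel_measurable_adahedge:
  assumes "\<And>s i. s \<in> {1..<t} \<Longrightarrow> i \<in> {1..K} \<Longrightarrow> (\<lambda>\<omega>. l \<omega> s i) \<in> borel_measurable N"
    and "i \<in> {1..K}"
  shows "(\<lambda>\<omega>. adahedge K (l \<omega>) t i) \<in> borel_measurable N"
  unfolding adahedge_def
proof (rule borel_measurable_hedge_weight)
  show "(\<lambda>\<omega>. adahedge_gap K (l \<omega>) (t - 1)) \<in> borel_measurable N"
    by (rule borel_measurable_adahedge_gap) (use assms in auto)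
  show "(\<lambda>\<omega>. cum_loss (l \<omega>) (t - 1) i) \<in> borel_measurable N" if "i \<in> {1..K}" for i
    by (rule borel_measurable_cum_loss) (use assms that in auto)
qed (rule assms(2))

section \<open>Concentration of the learner's loss\<close>

lemma adahedge_loss_eq: "adahedge_loss K l t = (\<Sum>i = 1..K. adahedge K l t i * l t i)"
  by (simp add: adahedge_loss_def hedge_loss_def adahedge_def)

lemma sum_adahedge: "K \<ge> 1 \<Longrightarrow> (\<Sum>i = 1..K. adahedge K l t i) = 1"
  using hedge_weight_sum[of K] by (simp add: adahedge_def)

lemma adahedge_nonneg: "adahedge K l t i \<ge> 0"
  by (simp add: adahedge_def hedge_weight_nonneg)

text \<open>
  \<open>p\<close> is the aggregate prediction and \<open>x\<close> the action. The constant \<open>8 / 21\<close> is dictated by the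
  theorem; \<open>excess_factor_mean_le\<close> still holds for a slightly larger one.
\<close>

definition excess_factor :: "real \<Rightarrow> real \<Rightarrow> real \<Rightarrow> real \<Rightarrow> real" where
  "excess_factor \<rho> p yt x = exp (8 * (1 - 2 * \<rho>) / 21 *
    (x * pred_loss yt (sgn p) + (1 - x) * \<rho> - pred_loss yt p + (1 - \<bar>p\<bar>) * (1 - 2 * \<rho>) / 4))"

lemma excess_factor_nonneg: "excess_factor \<rho> p yt x \<ge> 0"
  by (simp add: excess_factor_def)

text \<open>Conditionally on the past, the exponent of \<open>excess_factor\<close> takes two values of this form.\<close>

lemma two_point_exp_le:
  fixes b c d :: real
  assumes "exp c \<le> 1 + c + d" and "b \<ge> 0"
  shows "(1 - b) * exp (- c * b - d * b) + b * exp (c - c * b - d * b) \<le> 1"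
proof -
  have "(1 - b) * exp (- c * b - d * b) + b * exp (c - c * b - d * b)
      = (1 + b * (exp c - 1)) * exp (- c * b - d * b)"
    by (simp add: exp_diff exp_add exp_minus field_simps)
  \<comment> \<open>The moment generating function of a Bernoulli variable is at most that of a
    Poisson variable of the same mean, which leaves an exponent linear in \<open>b\<close>.\<close>
  also have "\<dots> \<le> exp (b * (exp c - 1)) * exp (- c * b - d * b)"
    by (intro mult_right_mono exp_ge_add_one_self) auto
  also have "\<dots> = exp (b * (exp c - (1 + c + d)))"
    by (simp add: algebra_simps flip: exp_add)
  also have "\<dots> \<le> 1" using assms by (simp add: mult_nonneg_nonpos)
  finally show ?thesis .
qed

lemma excess_factor_mean_le:
  assumes "0 \<le> \<rho>" "\<rho> < 1 / 2" and "\<bar>p\<bar> \<le> 1" and "yt \<in> {-1, 1}"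
  shows "\<bar>p\<bar> * excess_factor \<rho> p yt 1 + (1 - \<bar>p\<bar>) * excess_factor \<rho> p yt 0 \<le> 1"
proof -
  define g where "g = 1 - 2 * \<rho>"
  define q where "q = 8 * g / 21"
  define b where "b = 1 - \<bar>p\<bar>"
  have g: "0 < g" "g \<le> 1" using assms by (auto simp: g_def)
  have q: "0 < q" "q \<le> 8 / 21" using g by (auto simp: q_def)
  \<comment> \<open>Here \<open>z\<close> will be the abstention cost minus the loss of the sign:
    \<open>\<rho>\<close> if the sign is correct, \<open>\<rho> - 1\<close> otherwise. As
    \<open>q * z \<le> 1 / 2\<close>, the quadratic coefficient is 3 / 5, and
    \<open>8 / 21 * (3 / 5) = 8 / 35\<close> is below 1 / 4.\<close>
  have bern: "exp (q * z) \<le> 1 + q * z + q * g / 4" if z: "z\<^sup>2 \<le> 1" "z \<le> 1 / 2" for z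
  proof -
    have "q * z \<le> q * (1 / 2)" using q z by (intro mult_left_mono) auto
    then have "q * z \<le> 1 / 2" using q by linarith
    then have "exp (q * z) \<le> 1 + q * z + (q * z)\<^sup>2 / (2 * (1 - (1 / 2) / 3))"
      by (intro exp_le_bernstein) auto
    moreover have "(q * z)\<^sup>2 = q\<^sup>2 * z\<^sup>2" by (simp add: power_mult_distrib)
    moreover have "q\<^sup>2 * z\<^sup>2 \<le> q\<^sup>2 * 1" using z by (intro mult_left_mono) auto
    moreover have "q\<^sup>2 = q * g * (8 / 21)" by (simp add: q_def power2_eq_square)
    moreover have "q * g \<ge> 0" using q g by simp
    ultimately show ?thesis by simp
  qed
  consider "p = 0" | "p * yt > 0" | "p * yt < 0"
    using assms(4) by (cases p "0::real" rule: linorder_cases) auto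
  then show ?thesis
  proof cases
    case 1
    \<comment> \<open>\<open>sgn 0 = 0\<close> is not a label, but predicting then has probability 0
      and only the abstention factor counts.\<close>
    have "excess_factor \<rho> 0 yt 0 = exp (- (2 * g\<^sup>2 / 21))"
      unfolding excess_factor_def pred_loss_def g_def by (simp add: power2_eq_square field_simps)
    then show ?thesis using 1 by simp
  next
    case 2
    then have p: "p * yt = \<bar>p\<bar>" "sgn p * yt = 1" using assms(4) by (auto simp: abs_if)
    have "(1 - b) * exp (- (q * \<rho>) * b - q * g / 4 * b)
        + b * exp (q * \<rho> - q * \<rho> * b - q * g / 4 * b) \<le> 1"
    proof (intro two_point_exp_le bern)
      show "\<rho>\<^sup>2 \<le> 1" using assms by (intro power_le_one) auto
    qed (use assms in \<open>auto simp: b_def\<close>)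
    moreover have "excess_factor \<rho> p yt 1 = exp (- (q * \<rho>) * b - q * g / 4 * b)"
      unfolding excess_factor_def pred_loss_def p q_def g_def b_def
      by (simp add: field_simps)
    moreover have "excess_factor \<rho> p yt 0 = exp (q * \<rho> - q * \<rho> * b - q * g / 4 * b)"
      unfolding excess_factor_def pred_loss_def p q_def g_def b_def
      by (simp add: field_simps)
    ultimately show ?thesis by (simp add: b_def)
  next
    case 3
    then have p: "p * yt = - \<bar>p\<bar>" "sgn p * yt = - 1" using assms(4) by (auto simp: abs_if)
    have "(1 - b) * exp (- (q * (\<rho> - 1)) * b - q * g / 4 * b)
        + b * exp (q * (\<rho> - 1) - q * (\<rho> - 1) * b - q * g / 4 * b) \<le> 1"
    proof (intro two_point_exp_le bern)
      have "\<bar>\<rho> - 1\<bar> \<le> 1" using assms by auto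
      then show "(\<rho> - 1)\<^sup>2 \<le> 1" by (simp add: abs_square_le_1)
    qed (use assms in \<open>auto simp: b_def\<close>)
    moreover have "excess_factor \<rho> p yt 1 = exp (- (q * (\<rho> - 1)) * b - q * g / 4 * b)"
      unfolding excess_factor_def pred_loss_def p q_def g_def b_def
      by (simp add: field_simps)
    moreover have "excess_factor \<rho> p yt 0 = exp (q * (\<rho> - 1) - q * (\<rho> - 1) * b - q * g / 4 * b)"
      unfolding excess_factor_def pred_loss_def p q_def g_def b_def
      by (simp add: field_simps)
    ultimately show ?thesis by (simp add: b_def)
  qed
qed

text \<open>Serves integrability only, hence the crude constant.\<close>

lemma excess_factor_bound:
  assumes "0 \<le> \<rho>" "\<rho> < 1 / 2" and "\<bar>p\<bar> \<le> 1" and "yt \<in> {-1, 1}" and "x \<in> {0, 1}"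
  shows "excess_factor \<rho> p yt x \<le> exp 1"
proof -
  have "x * pred_loss yt (sgn p) + (1 - x) * \<rho> \<le> 1" "pred_loss yt p \<ge> 0"
    using assms by (auto simp: pred_loss_def sgn_if)
  moreover have "(1 - \<bar>p\<bar>) * (1 - 2 * \<rho>) \<le> 1 * 1" using assms by (intro mult_mono) auto
  ultimately have "8 * (1 - 2 * \<rho>) / 21 * (x * pred_loss yt (sgn p) + (1 - x) * \<rho> - pred_loss yt p
      + (1 - \<bar>p\<bar>) * (1 - 2 * \<rho>) / 4) \<le> 8 * (1 - 2 * \<rho>) / 21 * 2"
    using assms by (intro mult_left_mono) auto
  also have "\<dots> \<le> 1" using assms by simp
  finally show ?thesis by (simp add: excess_factor_def)
qed

text \<open>One supermartingale step: everything but the binary draw \<open>x\<close> is known to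
  \<open>F\<close>. Since the new factor is affine in \<open>x\<close>, the conditional probability
  of \<open>x = 1\<close> is all that is needed of its law.\<close>

lemma (in prob_space) expectation_randomized_mult_le:
  fixes S f1 f0 x q :: "'a \<Rightarrow> real"
  assumes sub: "subalgebra M F"
    and meas: "S \<in> borel_measurable F" "f1 \<in> borel_measurable F" "f0 \<in> borel_measurable F"
    and x: "x \<in> borel_measurable M" "\<And>\<omega>. \<omega> \<in> space M \<Longrightarrow> x \<omega> \<in> {0, 1}"
    and bound: "\<And>\<omega>. \<omega> \<in> space M \<Longrightarrow> S \<omega> \<in> {0..B}" "\<And>\<omega>. \<omega> \<in> space M \<Longrightarrow> f1 \<omega> \<in> {0..C}"
      "\<And>\<omega>. \<omega> \<in> space M \<Longrightarrow> f0 \<omega> \<in> {0..C}"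
    and cond: "AE \<omega> in M. real_cond_exp M F (indicator {\<omega> \<in> space M. x \<omega> = 1}) \<omega> = q \<omega>"
    and mean: "\<And>\<omega>. \<omega> \<in> space M \<Longrightarrow> q \<omega> * f1 \<omega> + (1 - q \<omega>) * f0 \<omega> \<le> 1"
  shows "expectation (\<lambda>\<omega>. S \<omega> * (x \<omega> * f1 \<omega> + (1 - x \<omega>) * f0 \<omega>)) \<le> expectation S"
proof -
  interpret finite_measure_subalgebra M F by unfold_locales (rule sub)
  let ?X = "{\<omega> \<in> space M. x \<omega> = 1}"
  note [measurable] = measurable_from_subalg[OF sub meas(1)] measurable_from_subalg[OF sub meas(2)]
    measurable_from_subalg[OF sub meas(3)] x(1)
  let ?D = "\<lambda>\<omega>. S \<omega> * (f1 \<omega> - f0 \<omega>)"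
  have D: "?D \<in> borel_measurable F" using meas by measurable
  have bnd: "\<bar>S \<omega> * f1 \<omega>\<bar> \<le> B * C" "\<bar>S \<omega> * f0 \<omega>\<bar> \<le> B * C" if "\<omega> \<in> space M" for \<omega>
    using bound[OF that] by (auto simp: abs_mult intro!: mult_mono)
  have int: "integrable M S" "integrable M (\<lambda>\<omega>. S \<omega> * f1 \<omega>)" "integrable M (\<lambda>\<omega>. S \<omega> * f0 \<omega>)"
    using bound(1) bnd by (auto intro: integrable_const_bound[where B = B]
        integrable_const_bound[where B = "B * C"])
  then have intD: "integrable M (\<lambda>\<omega>. ?D \<omega> * indicator ?X \<omega>)"
    by (intro integrable_mult_indicator[where 'b = real, simplified mult.commute real_scaleR_def])
      (auto simp: right_diff_distrib)
  note cexp = real_cond_exp_intg[OF intD D, simplified]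
  have "expectation (\<lambda>\<omega>. S \<omega> * (x \<omega> * f1 \<omega> + (1 - x \<omega>) * f0 \<omega>))
      = expectation (\<lambda>\<omega>. ?D \<omega> * indicator ?X \<omega> + S \<omega> * f0 \<omega>)"
    by (rule Bochner_Integration.integral_cong) (use x(2) in \<open>auto simp: algebra_simps indicator_def\<close>)
  also have "\<dots> = expectation (\<lambda>\<omega>. ?D \<omega> * indicator ?X \<omega>) + expectation (\<lambda>\<omega>. S \<omega> * f0 \<omega>)"
    by (rule Bochner_Integration.integral_add[OF intD int(3)])
  \<comment> \<open>\<open>?D\<close> is \<open>F\<close>-measurable, so the indicator may be
    replaced by its conditional expectation under the integral.\<close>
  also have "\<dots> = expectation (\<lambda>\<omega>. ?D \<omega> * real_cond_exp M F (indicator ?X) \<omega> + S \<omega> * f0 \<omega>)"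
    using cexp int by (simp add: Bochner_Integration.integral_add)
  also have "\<dots> \<le> expectation S"
  proof (rule integral_mono_AE)
    show "AE \<omega> in M. ?D \<omega> * real_cond_exp M F (indicator ?X) \<omega> + S \<omega> * f0 \<omega> \<le> S \<omega>"
      using cond AE_space
    proof eventually_elim
      case (elim \<omega>)
      have "S \<omega> * (q \<omega> * f1 \<omega> + (1 - q \<omega>) * f0 \<omega>) \<le> S \<omega> * 1"
        using bound(1) mean elim by (intro mult_left_mono) auto
      then show ?case using elim by (simp add: algebra_simps)
    qed
  qed (use cexp int in auto)
  finally show ?thesis .
qed

section \<open>AdaHedge inside the game: measurability and regret of the aggregate\<close>

context abstention_game
begin

text \<open>The sample point comes first so that \<open>expert_loss \<omega>\<close> has the type of
  losses that AdaHedge takes.\<close>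

definition expert_loss :: "'w \<Rightarrow> nat \<Rightarrow> nat \<Rightarrow> real" where
  "expert_loss \<omega> s j = pred_loss (y s \<omega>) (e s j \<omega>)"

lemma expert_loss_range:
  assumes "\<omega> \<in> space M" "t \<in> {1..T}" "i \<in> {1..K}"
  shows "expert_loss \<omega> t i \<in> {0..1}"
  using expert_range[OF assms(2,3,1)] outcome_range[OF assms(2,1)]
  by (auto simp: expert_loss_def pred_loss_def)

lemma aggregate_eq: "aggregate K e y t \<omega> = (\<Sum>i = 1..K. adahedge K (expert_loss \<omega>) t i * e t i \<omega>)"
  by (simp add: aggregate_def expert_loss_def[abs_def])

lemma abs_aggregate_le:
  assumes "\<omega> \<in> space M" "t \<in> {1..T}"
  shows "\<bar>aggregate K e y t \<omega>\<bar> \<le> 1"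
proof -
  have "\<bar>aggregate K e y t \<omega>\<bar> \<le> (\<Sum>i = 1..K. \<bar>adahedge K (expert_loss \<omega>) t i * e t i \<omega>\<bar>)"
    unfolding aggregate_eq by (rule sum_abs)
  also have "\<dots> \<le> (\<Sum>i = 1..K. adahedge K (expert_loss \<omega>) t i * 1)"
  proof (rule sum_mono)
    fix i assume "i \<in> {1..K}"
    then have "\<bar>e t i \<omega>\<bar> \<le> 1" using expert_range[OF assms(2) _ assms(1), of i] by auto
    then show "\<bar>adahedge K (expert_loss \<omega>) t i * e t i \<omega>\<bar> \<le> adahedge K (expert_loss \<omega>) t i * 1"
      unfolding abs_mult by (intro mult_mono) (auto simp: adahedge_nonneg)
  qed
  also have "\<dots> = 1" using sum_adahedge[OF K_pos] by simp
  finally show ?thesis .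
qed

lemma measurable_later:
  assumes "f \<in> borel_measurable (G s)" and "s \<le> t"
  shows "f \<in> borel_measurable (G t)"
proof (rule measurable_from_subalg[OF _ assms(1)])
  show "subalgebra (G t) (G s)"
    using space_F sets_F_mono[OF assms(2)] by (simp add: subalgebra_def)
qed

lemma expert_loss_measurable:
  assumes "s \<in> {1..T}" "s \<le> t" "i \<in> {1..K}"
  shows "(\<lambda>\<omega>. expert_loss \<omega> s i) \<in> borel_measurable (G t)"
proof -
  have "(\<lambda>\<omega>. expert_loss \<omega> s i) \<in> borel_measurable (G s)"
    unfolding expert_loss_def pred_loss_def
    using expert_measurable[OF assms(1,3)] outcome_measurable[OF assms(1)] by measurable
  then show ?thesis using assms(2) by (rule measurable_later)
qed

lemma aggregate_measurable:
  assumes "t \<in> {1..T}"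
  shows "aggregate K e y t \<in> borel_measurable (G t)"
proof -
  have "(\<lambda>\<omega>. \<Sum>i = 1..K. adahedge K (expert_loss \<omega>) t i * e t i \<omega>) \<in> borel_measurable (G t)"
    by (intro borel_measurable_sum borel_measurable_times borel_measurable_adahedge
        expert_loss_measurable expert_measurable) (use assms in auto)
  then show ?thesis unfolding aggregate_eq[symmetric] .
qed

text \<open>The loss is affine in the prediction and the weights sum to 1, so averaging commutes
  with it.\<close>

lemma adahedge_loss_expert_loss:
  "adahedge_loss K (expert_loss \<omega>) t = pred_loss (y t \<omega>) (aggregate K e y t \<omega>)"
proof -
  have "adahedge_loss K (expert_loss \<omega>) t = ((\<Sum>i = 1..K. adahedge K (expert_loss \<omega>) t i)
      - (\<Sum>i = 1..K. adahedge K (expert_loss \<omega>) t i * e t i \<omega>) * y t \<omega>) / 2"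
    unfolding adahedge_loss_eq
    by (simp add: expert_loss_def pred_loss_def sum_distrib_right sum_subtractf right_diff_distrib
        mult.assoc flip: sum_divide_distrib)
  then show ?thesis unfolding sum_adahedge[OF K_pos] aggregate_eq by (simp add: pred_loss_def)
qed

text \<open>With aggregate \<open>p\<close>, the bound \<open>h * (1 - h)\<close> equals
  \<open>(1 - \<bar>p\<bar>) * (1 + \<bar>p\<bar>) / 4\<close> whatever the outcome.\<close>

lemma adahedge_var_le_abstain_prob:
  assumes "\<omega> \<in> space M" "t \<in> {1..T}"
  shows "adahedge_var K (expert_loss \<omega>) t \<le> abstain_prob K e y t \<omega> / 2"
proof -
  let ?p = "aggregate K e y t \<omega>" and ?h = "adahedge_loss K (expert_loss \<omega>) t"
  have "adahedge_var K (expert_loss \<omega>) t \<le> ?h * (1 - ?h)"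
    unfolding adahedge_var_def adahedge_loss_def
    by (rule hedge_var_le[OF K_pos]) (use expert_loss_range assms in auto)
  also have "\<dots> = (1 - \<bar>?p\<bar>) * ((1 + \<bar>?p\<bar>) / 4)"
    unfolding adahedge_loss_expert_loss using outcome_range[OF assms(2,1)]
    by (auto simp: pred_loss_def abs_if field_simps)
  also have "\<dots> \<le> (1 - \<bar>?p\<bar>) * (1 / 2)"
    using abs_aggregate_le[OF assms] by (intro mult_left_mono) auto
  finally show ?thesis by (simp add: abstain_prob_def)
qed

lemma aggregate_regret:
  assumes "\<omega> \<in> space M" "i \<in> {1..K}" and "\<gamma> > 0"
  shows "(\<Sum>t = 1..T. pred_loss (y t \<omega>) (aggregate K e y t \<omega>))
    \<le> (\<Sum>t = 1..T. pred_loss (y t \<omega>) (e t i \<omega>)) + \<gamma> / 4 * (\<Sum>t = 1..T. abstain_prob K e y t \<omega>)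
      + 2 * ln K / \<gamma> + 4 / 3 * ln K + 2"
proof -
  define V where "V = (\<Sum>t = 1..T. adahedge_var K (expert_loss \<omega>) t)"
  have V: "V \<le> (\<Sum>t = 1..T. abstain_prob K e y t \<omega>) / 2"
    unfolding V_def sum_divide_distrib using assms by (intro sum_mono adahedge_var_le_abstain_prob) auto
  have V0: "V \<ge> 0" unfolding V_def adahedge_var_def by (intro sum_nonneg hedge_var_nonneg)
  \<comment> \<open>Factors chosen for the arithmetic-geometric mean inequality: the weight \<gamma>
    trades the root for a small multiple of the abstention sum.\<close>
  have "2 * sqrt (ln K * V) = 2 * sqrt ((2 * ln K / \<gamma>) * (\<gamma> / 2 * V))"
    using assms(3) by simp
  also have "\<dots> \<le> 2 * ln K / \<gamma> + \<gamma> / 2 * V"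
    using arith_geo_mean_sqrt[of "2 * ln K / \<gamma>" "\<gamma> / 2 * V"] V0 K_pos assms(3) by simp
  also have "\<dots> \<le> 2 * ln K / \<gamma> + \<gamma> / 2 * ((\<Sum>t = 1..T. abstain_prob K e y t \<omega>) / 2)"
    using V assms(3) by (intro add_left_mono mult_left_mono) auto
  finally have "2 * sqrt (ln K * V)
    \<le> 2 * ln K / \<gamma> + \<gamma> / 4 * (\<Sum>t = 1..T. abstain_prob K e y t \<omega>)" by simp
  moreover have "(\<Sum>t = 1..T. adahedge_loss K (expert_loss \<omega>) t)
    \<le> cum_loss (expert_loss \<omega>) T i + 2 * sqrt (ln K * V) + 4 / 3 * ln K + 2"
    unfolding V_def by (rule adahedge_regret[OF K_pos]) (use expert_loss_range assms in auto)
  ultimately show ?thesis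
    by (simp add: adahedge_loss_expert_loss cum_loss_def expert_loss_def)
qed

section \<open>The supermartingale and the tail bound\<close>

definition excess_product :: "real \<Rightarrow> nat \<Rightarrow> 'w \<Rightarrow> real" where
  "excess_product \<rho> t \<omega> = (\<Prod>s = 1..t. excess_factor \<rho> (aggregate K e y s \<omega>) (y s \<omega>) (a s \<omega>))"

lemma excess_factor_measurable:
  assumes "t \<in> {1..T}" and "t \<le> u" and "x \<in> borel_measurable (G u)"
  shows "(\<lambda>\<omega>. excess_factor \<rho> (aggregate K e y t \<omega>) (y t \<omega>) (x \<omega>)) \<in> borel_measurable (G u)"
  unfolding excess_factor_def pred_loss_def
  using measurable_later[OF aggregate_measurable[OF assms(1)] assms(2)]
    measurable_later[OF outcome_measurable[OF assms(1)] assms(2)] assms(3) by measurable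

text \<open>The index shifts because \<open>a t\<close> is known only from \<open>G (Suc t)\<close>
  on; the product through round \<open>t\<close> is thus known when the next action is
  drawn.\<close>

lemma excess_product_measurable:
  assumes "t \<le> T"
  shows "excess_product \<rho> t \<in> borel_measurable (G (Suc t))"
  unfolding excess_product_def[abs_def]
  by (intro borel_measurable_prod excess_factor_measurable)
    (use assms in \<open>auto intro: measurable_later[OF action_measurable]\<close>)

lemma excess_product_range:
  assumes "0 \<le> \<rho>" "\<rho> < 1 / 2" "t \<le> T" "\<omega> \<in> space M"
  shows "excess_product \<rho> t \<omega> \<in> {0..exp 1 ^ t}"
proof -
  have "excess_product \<rho> t \<omega> \<le> (\<Prod>s = 1..t. exp 1)"
    unfolding excess_product_def
    by (intro prod_mono conjI excess_factor_bound abs_aggregate_le outcome_range action_range)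
      (use assms in \<open>auto simp: excess_factor_nonneg\<close>)
  moreover have "excess_product \<rho> t \<omega> \<ge> 0"
    unfolding excess_product_def by (intro prod_nonneg) (simp add: excess_factor_nonneg)
  ultimately show ?thesis by simp
qed

lemma excess_product_eq_exp:
  "excess_product \<rho> t \<omega> = exp (8 * (1 - 2 * \<rho>) / 21 *
    ((\<Sum>s = 1..t. a s \<omega> * pred_loss (y s \<omega>) (sgn (aggregate K e y s \<omega>)) + (1 - a s \<omega>) * \<rho>)
      - (\<Sum>s = 1..t. pred_loss (y s \<omega>) (aggregate K e y s \<omega>))
      + (1 - 2 * \<rho>) / 4 * (\<Sum>s = 1..t. abstain_prob K e y s \<omega>)))"
  unfolding excess_product_def excess_factor_def exp_sum[symmetric, OF finite_atLeastAtMost]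
    sum_distrib_left sum_subtractf[symmetric] sum.distrib[symmetric]
  by (simp add: abstain_prob_def mult.commute)

end

lemma (in adahedge_with_abstention) expectation_excess_product:
  assumes "0 \<le> \<rho>" "\<rho> < 1 / 2" and "t \<le> T"
  shows "expectation (excess_product \<rho> t) \<le> 1"
  using assms(3)
proof (induction t)
  case 0
  then show ?case by (simp add: excess_product_def[abs_def] prob_space)
next
  case (Suc t)
  then have t: "Suc t \<in> {1..T}" by auto
  let ?p = "aggregate K e y (Suc t)"
  let ?f = "\<lambda>x \<omega>. excess_factor \<rho> (?p \<omega>) (y (Suc t) \<omega>) x"
  \<comment> \<open>As the action is 0 or 1, the new factor can be written as affine in it, with
    coefficients known before the draw.\<close>
  have "expectation (excess_product \<rho> (Suc t))
    = expectation (\<lambda>\<omega>. excess_product \<rho> t \<omega> * (a (Suc t) \<omega> * ?f 1 \<omega> + (1 - a (Suc t) \<omega>) * ?f 0 \<omega>))"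
  proof (rule Bochner_Integration.integral_cong[OF refl])
    fix \<omega> assume "\<omega> \<in> space M"
    then have "a (Suc t) \<omega> = 0 \<or> a (Suc t) \<omega> = 1" using action_range[OF t] by blast
    then show "excess_product \<rho> (Suc t) \<omega>
      = excess_product \<rho> t \<omega> * (a (Suc t) \<omega> * ?f 1 \<omega> + (1 - a (Suc t) \<omega>) * ?f 0 \<omega>)"
      by (auto simp: excess_product_def)
  qed
  also have "\<dots> \<le> expectation (excess_product \<rho> t)"
  proof (rule expectation_randomized_mult_le[OF subalg])
    show "excess_product \<rho> t \<in> borel_measurable (G (Suc t))"
      using Suc.prems by (intro excess_product_measurable) auto
    show "?f 1 \<in> borel_measurable (G (Suc t))" "?f 0 \<in> borel_measurable (G (Suc t))"
      using t by (auto intro: excess_factor_measurable)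
    show "a (Suc t) \<in> borel_measurable M"
      using measurable_from_subalg[OF subalg action_measurable[OF t]] .
    show "AE \<omega> in M. real_cond_exp M (G (Suc t)) (indicator {\<omega> \<in> space M. a (Suc t) \<omega> = 1}) \<omega> = \<bar>?p \<omega>\<bar>"
      using action_distr[OF t] by (simp add: abstain_prob_def)
    fix \<omega> assume \<omega>: "\<omega> \<in> space M"
    show "a (Suc t) \<omega> \<in> {0, 1}" by (rule action_range[OF t \<omega>])
    show "excess_product \<rho> t \<omega> \<in> {0..exp 1 ^ t}"
      using excess_product_range assms(1,2) Suc.prems \<omega> by simp
    show "?f 1 \<omega> \<in> {0..exp 1}" "?f 0 \<omega> \<in> {0..exp 1}"
      using excess_factor_bound[OF assms(1,2) abs_aggregate_le[OF \<omega> t] outcome_range[OF t \<omega>], of 1]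
        excess_factor_bound[OF assms(1,2) abs_aggregate_le[OF \<omega> t] outcome_range[OF t \<omega>], of 0]
      by (simp_all add: excess_factor_nonneg)
    show "\<bar>?p \<omega>\<bar> * ?f 1 \<omega> + (1 - \<bar>?p \<omega>\<bar>) * ?f 0 \<omega> \<le> 1"
      by (rule excess_factor_mean_le[OF assms(1,2) abs_aggregate_le[OF \<omega> t] outcome_range[OF t \<omega>]])
  qed
  also have "\<dots> \<le> 1" using Suc by simp
  finally show ?case .
qed

theorem theorem23:
  fixes M :: "'w measure" and G :: "nat \<Rightarrow> 'w measure"
    and K T :: nat
    and e :: "nat \<Rightarrow> nat \<Rightarrow> 'w \<Rightarrow> real"
    and y a :: "nat \<Rightarrow> 'w \<Rightarrow> real"
    and istar :: "'w \<Rightarrow> nat"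
    and \<rho> \<delta> :: real
  assumes "0 \<le> \<rho>" and "\<rho> < 1 / 2" and "0 < \<delta>" and "\<delta> < 1"
    and "adahedge_with_abstention M G K T e y a"
    and "\<And>\<omega>. \<omega> \<in> space M \<Longrightarrow>
      is_arg_min (\<lambda>i. \<Sum>t = 1..T. pred_loss (y t \<omega>) (e t i \<omega>)) (\<lambda>i. i \<in> {1..K}) (istar \<omega>)"
  shows "measure M {\<omega> \<in> space M.
      (\<Sum>t = 1..T. a t \<omega> * pred_loss (y t \<omega>) (sgn (aggregate K e y t \<omega>)) + (1 - a t \<omega>) * \<rho>)
      \<le> (\<Sum>t = 1..T. pred_loss (y t \<omega>) (e t (istar \<omega>) \<omega>))
        + 2 * ln (real K) / (1 - 2 * \<rho>)
        + 21 * ln (1 / \<delta>) / (8 * (1 - 2 * \<rho>))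
        + 4 / 3 * ln (real K) + 2} \<ge> 1 - \<delta>"
proof -
  interpret adahedge_with_abstention M G K T e y a by fact
  let ?X = "\<lambda>\<omega>. \<Sum>t = 1..T. a t \<omega> * pred_loss (y t \<omega>) (sgn (aggregate K e y t \<omega>)) + (1 - a t \<omega>) * \<rho>"
  let ?Y = "\<lambda>i \<omega>. \<Sum>t = 1..T. pred_loss (y t \<omega>) (e t i \<omega>)"
  define g where "g = 1 - 2 * \<rho>"
  have g: "g > 0" using assms(2) by (simp add: g_def)
  define c where "c = 2 * ln (real K) / g + 21 * ln (1 / \<delta>) / (8 * g) + 4 / 3 * ln (real K) + 2"
  define E where "E = {\<omega> \<in> space M. ?X \<omega> \<le> ?Y (istar \<omega>) \<omega> + c}"
  let ?S = "excess_product \<rho> T"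
  note from_G = measurable_from_subalg[OF subalg]
  have meas: "aggregate K e y t \<in> borel_measurable M" "y t \<in> borel_measurable M"
      "a t \<in> borel_measurable M" "i \<in> {1..K} \<Longrightarrow> e t i \<in> borel_measurable M"
    if "t \<in> {1..T}" for t i
    using that by (auto intro: from_G[OF aggregate_measurable] from_G[OF outcome_measurable]
        from_G[OF action_measurable] from_G[OF expert_measurable])
  have S: "?S \<in> borel_measurable M" by (rule from_G[OF excess_product_measurable]) simp
  \<comment> \<open>\<open>istar\<close> is not assumed measurable. Ranging over all experts instead
    expresses \<open>E\<close> by finitely many measurable conditions.\<close>
  have E_eq: "E = {\<omega> \<in> space M. \<forall>i\<in>{1..K}. ?X \<omega> \<le> ?Y i \<omega> + c}"
    using assms(6) unfolding E_def is_arg_min_linorder by fastforce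
  have "E \<in> sets M" unfolding E_eq pred_loss_def using meas by measurable
  have bad: "space M - E \<subseteq> {\<omega> \<in> space M. ?S \<omega> \<ge> 1 / \<delta>}"
  proof safe
    fix \<omega> assume \<omega>: "\<omega> \<in> space M" and "\<omega> \<notin> E"
    then obtain i where i: "i \<in> {1..K}" "?X \<omega> > ?Y i \<omega> + c" unfolding E_eq by force
    define Z where "Z = ?X \<omega> - (\<Sum>s = 1..T. pred_loss (y s \<omega>) (aggregate K e y s \<omega>))
      + g / 4 * (\<Sum>s = 1..T. abstain_prob K e y s \<omega>)"
    \<comment> \<open>With \<open>\<gamma> = g\<close> the abstention sums and the regret terms
      cancel, leaving the part of \<open>c\<close> in \<open>ln (1 / \<delta>)\<close>.\<close>
    have "Z \<ge> 21 * ln (1 / \<delta>) / (8 * g)"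
      using aggregate_regret[OF \<omega> i(1) g] i(2) unfolding Z_def c_def by linarith
    then have "8 * g / 21 * (21 * ln (1 / \<delta>) / (8 * g)) \<le> 8 * g / 21 * Z"
      using g by (intro mult_left_mono) auto
    then have "ln (1 / \<delta>) \<le> 8 * g / 21 * Z" using g by simp
    then have "exp (ln (1 / \<delta>)) \<le> exp (8 * g / 21 * Z)" by (simp only: exp_le_cancel_iff)
    also have "\<dots> = ?S \<omega>" unfolding excess_product_eq_exp Z_def g_def ..
    finally show "1 / \<delta> \<le> ?S \<omega>" using assms(3) by simp
  qed
  have range: "?S \<omega> \<in> {0..exp 1 ^ T}" if "\<omega> \<in> space M" for \<omega>
    using excess_product_range[OF assms(1,2) _ that] by simp
  have "integrable M ?S" using range S by (intro integrable_const_bound[where B = "exp 1 ^ T"]) auto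
  \<comment> \<open>Markov's inequality at level \<open>1 / \<delta>\<close>, the value that
    \<open>?S\<close> reaches outside \<open>E\<close>.\<close>
  then have "prob {\<omega> \<in> space M. ?S \<omega> \<ge> 1 / \<delta>} \<le> expectation ?S / (1 / \<delta>)"
    using assms(3) range by (intro integral_Markov_inequality_measure[of M ?S "{}"]) auto
  also have "\<dots> \<le> \<delta>"
    using expectation_excess_product[OF assms(1,2) order_refl] assms(3) by (simp add: mult_left_le_one_le)
  finally have "prob {\<omega> \<in> space M. ?S \<omega> \<ge> 1 / \<delta>} \<le> \<delta>" .
  moreover have "prob (space M - E) \<le> prob {\<omega> \<in> space M. ?S \<omega> \<ge> 1 / \<delta>}"
    using bad S by (intro finite_measure_mono) measurable
  ultimately have "1 - \<delta> \<le> prob E" using prob_compl[OF \<open>E \<in> sets M\<close>] by simp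
  then show ?thesis by (simp add: E_def c_def g_def add.assoc)
qed

end
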